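(* Let $\alpha>1$ be a real number and let $m_1,m_\alpha$ be real numbers with $m_1>0$ and $m_\alpha>m_1^\alpha$. Then for every $q$ with $$0\le q\le \left(\frac{\alpha-1}{\alpha}\right)\left(\frac{m_\alpha}{m_1}\right)^{1/(\alpha-1)},$$ one has $$\sup_{F\in\mathcal F_{1,\alpha}}\mathbb E_F[\tilde d-q]_+ \;=\; m_1-q\left(\frac{m_1^\alpha}{m_\alpha}\right)^{1/(\alpha-1)}.$$ Moreover, for every such $q$ the supremum is attained by the two-point distribution (which lies in $\mathcal F_{1,\alpha}$ and does not depend on $q$) of the random variable equal to $0$ with probability $1-\left(\frac{m_1^\alpha}{m_\alpha}\right)^{1/(\alpha-1)}$ and equal to $\left(\frac{m_\alpha}{m_1}\right)^{1/(\alpha-1)}$ with probability $\left(\frac{m_1^\alpha}{m_\alpha}\right)^{1/(\alpha-1)}$.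
   Context: $\mathcal F_{1,\alpha}$ denotes the set of all Borel probability distributions $F$ on $[0,\infty)$ with $\int_0^\infty w\,dF(w)=m_1$ and $\int_0^\infty w^\alpha\,dF(w)=m_\alpha$. For $F\in\mathcal F_{1,\alpha}$, $\tilde d$ denotes a random variable with distribution $F$, and $\mathbb E_F[\tilde d-q]_+=\int_0^\infty \max(0,w-q)\,dF(w)$. *)

theory Defs
  imports "HOL-Probability.Probability"
begin

text \<open>A Borel distribution on \<open>[0,\<infinity>)\<close> is represented as a Borel probability
  measure on the real line that gives full mass to \<open>[0,\<infinity>)\<close>. Integrability is required
  explicitly because the Bochner integral of a non-integrable function is \<open>0\<close>.\<close>

definition moment_class :: "real \<Rightarrow> real \<Rightarrow> real \<Rightarrow> real measure set" where
  "moment_class \<alpha> m1 m\<alpha> =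
    {F. real_distribution F \<and> (AE w in F. 0 \<le> w)
      \<and> set_integrable F {0..} (\<lambda>w. w) \<and> (LINT w:{0..}|F. w) = m1
      \<and> set_integrable F {0..} (\<lambda>w. w powr \<alpha>) \<and> (LINT w:{0..}|F. w powr \<alpha>) = m\<alpha>}"

text \<open>No integrability clause is needed here: on \<open>moment_class\<close> the integrand with
  \<open>q \<ge> 0\<close> is dominated by the integrable function \<open>w\<close>.\<close>

definition expected_excess :: "real measure \<Rightarrow> real \<Rightarrow> real" where
  "expected_excess F q = (LINT w:{0..}|F. max 0 (w - q))"

text \<open>The law of a random variable equal to \<open>x\<close> with probability \<open>p\<close> and to \<open>0\<close> with
  probability \<open>1 - p\<close>; meaningful only for \<open>0 \<le> p \<le> 1\<close>.\<close>

definition two_point_dist :: "real \<Rightarrow> real \<Rightarrow> real measure" where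
  "two_point_dist p x =
    distr (measure_pmf (bernoulli_pmf p)) borel (\<lambda>b. if b then x else 0)"

end

theory Submission
  imports Defs
begin

text \<open>On \<open>[0,\<infinity>)\<close> the excess \<open>max 0 (w - q)\<close> is dominated by the function
  \<open>a * w + b * w powr \<alpha>\<close> that is tangent to \<open>w - q\<close> at \<open>w = x\<close>; the bound on \<open>q\<close> is exactly
  the condition \<open>a \<ge> 0\<close>. Integrating the majorant uses only the two prescribed moments, and
  there is equality for a distribution supported on the contact points \<open>0\<close> and \<open>x\<close>.\<close>

text \<open>Young's inequality for the numbers 1 and \<open>t powr a\<close> with weights
  \<open>1 - 1 / a\<close> and \<open>1 / a\<close>. It is applied to positive numbers, so
  \<open>t = 0\<close> is split off.\<close>

lemma bernoulli_inequality_powr: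
  fixes t a :: real
  assumes "0 \<le> t" "1 \<le> a"
  shows "a * t \<le> t powr a + (a - 1)"
proof (cases "t = 0")
  case False
  have "1 powr (1 - 1 / a) * (t powr a) powr (1 / a) \<le> (1 - 1 / a) * 1 + (1 / a) * t powr a"
    using assms False by (intro Youngs_inequality_0) auto
  also have "1 powr (1 - 1 / a) * (t powr a) powr (1 / a) = t"
    using assms by (simp add: powr_powr)
  finally have "t \<le> (1 - 1 / a) * 1 + (1 / a) * t powr a" .
  then have "a * t \<le> a * ((1 - 1 / a) * 1 + (1 / a) * t powr a)"
    using assms by (intro mult_left_mono) auto
  also have "\<dots> = t powr a + (a - 1)"
    using assms by (simp add: distrib_left right_diff_distrib)
  finally show ?thesis .
qed (use assms in auto)

lemma excess_le_tangent_majorant: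
  fixes \<alpha> q w x :: real
  assumes "\<alpha> > 1" "x > 0" "0 \<le> q" "q \<le> ((\<alpha> - 1) / \<alpha>) * x" "0 \<le> w"
  shows "max 0 (w - q) \<le> (1 - q * \<alpha> / ((\<alpha> - 1) * x)) * w + q / ((\<alpha> - 1) * x powr \<alpha>) * w powr \<alpha>"
proof (rule max.boundedI)
  have "q * \<alpha> / ((\<alpha> - 1) * x) \<le> 1"
    using assms by (simp add: field_simps)
  then show "0 \<le> (1 - q * \<alpha> / ((\<alpha> - 1) * x)) * w + q / ((\<alpha> - 1) * x powr \<alpha>) * w powr \<alpha>"
    using assms by simp
next
  \<comment> \<open>Rescaling by \<open>t = w / x\<close> moves the contact point from 1 to
    \<open>x\<close>; the factor \<open>q / (\<alpha> - 1)\<close> then turns the constant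
    \<open>\<alpha> - 1\<close> into \<open>q\<close>.\<close>
  have "\<alpha> * (w / x) \<le> (w / x) powr \<alpha> + (\<alpha> - 1)"
    using assms by (intro bernoulli_inequality_powr) auto
  then have "q / (\<alpha> - 1) * (\<alpha> * (w / x)) \<le> q / (\<alpha> - 1) * ((w / x) powr \<alpha> + (\<alpha> - 1))"
    using assms by (intro mult_left_mono) auto
  also have "\<dots> = q / ((\<alpha> - 1) * x powr \<alpha>) * w powr \<alpha> + q"
    using assms by (simp add: powr_divide distrib_left)
  finally show "w - q \<le> (1 - q * \<alpha> / ((\<alpha> - 1) * x)) * w + q / ((\<alpha> - 1) * x powr \<alpha>) * w powr \<alpha>"
    by (simp add: algebra_simps)
qed

text \<open>Weak duality: each contact point \<open>x\<close> admissible for \<open>q\<close> yields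
  a bound through the two moments alone. The optimal \<open>x\<close> is fixed only in the final
  theorem.\<close>

lemma expected_excess_le:
  fixes \<alpha> m1 m\<alpha> q x :: real
  assumes "\<alpha> > 1" "x > 0" "0 \<le> q" "q \<le> ((\<alpha> - 1) / \<alpha>) * x"
    and F: "F \<in> moment_class \<alpha> m1 m\<alpha>"
  shows "expected_excess F q
    \<le> (1 - q * \<alpha> / ((\<alpha> - 1) * x)) * m1 + q / ((\<alpha> - 1) * x powr \<alpha>) * m\<alpha>"
proof -
  let ?a = "1 - q * \<alpha> / ((\<alpha> - 1) * x)" and ?b = "q / ((\<alpha> - 1) * x powr \<alpha>)"
  have "real_distribution F"
    and i1: "set_integrable F {0..} (\<lambda>w. w)" and m1: "(LINT w:{0..}|F. w) = m1"
    and i\<alpha>: "set_integrable F {0..} (\<lambda>w. w powr \<alpha>)"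
    and m\<alpha>: "(LINT w:{0..}|F. w powr \<alpha>) = m\<alpha>"
    using F by (auto simp: moment_class_def)
  then interpret real_distribution F by simp
  have j1: "set_integrable F {0..} (\<lambda>w. ?a * w)" and j\<alpha>: "set_integrable F {0..} (\<lambda>w. ?b * w powr \<alpha>)"
    using i1 i\<alpha> by (auto intro!: set_integrable_mult_right)
  have j: "set_integrable F {0..} (\<lambda>w. ?a * w + ?b * w powr \<alpha>)"
    by (rule set_integral_add(1)[OF j1 j\<alpha>])
  \<comment> \<open>Comparing Bochner integrals requires the excess to be integrable; as
    \<open>q \<ge> 0\<close>, it is dominated by \<open>w\<close> on the half-line.\<close>
  have "set_integrable F {0..} (\<lambda>w. max 0 (w - q))"
    unfolding set_integrable_def
  proof (rule Bochner_Integration.integrable_bound[OF i1[unfolded set_integrable_def]])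
    show "AE w in F. norm (indicator {0..} w *\<^sub>R max 0 (w - q)) \<le> norm (indicator {0..} w *\<^sub>R w)"
      using \<open>0 \<le> q\<close> by (auto simp: indicator_def)
  qed simp
  then have "expected_excess F q \<le> (LINT w:{0..}|F. ?a * w + ?b * w powr \<alpha>)"
    unfolding expected_excess_def using j assms
    by (intro set_integral_mono excess_le_tangent_majorant) auto
  also have "\<dots> = ?a * m1 + ?b * m\<alpha>"
    using set_integral_add(2)[OF j1 j\<alpha>] m1 m\<alpha> by simp
  finally show ?thesis .
qed

lemma real_distribution_two_point_dist: "real_distribution (two_point_dist p x)"
  unfolding two_point_dist_def real_distribution_def real_distribution_axioms_def
  by (auto intro!: measure_pmf.prob_space_distr)

lemma set_integrable_two_point_dist:
  fixes f :: "real \<Rightarrow> real"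
  assumes [measurable]: "f \<in> borel_measurable borel"
  shows "set_integrable (two_point_dist p x) {0..} f"
  unfolding set_integrable_def two_point_dist_def
  by (subst integrable_distr_eq) (auto intro!: integrable_measure_pmf_finite)

text \<open>Since \<open>0 \<le> x\<close>, both atoms lie in \<open>{0..}\<close> and the indicator
  is 1 at each.\<close>

lemma set_integral_two_point_dist:
  fixes f :: "real \<Rightarrow> real"
  assumes [measurable]: "f \<in> borel_measurable borel" and "0 \<le> p" "p \<le> 1" "0 \<le> x"
  shows "(LINT w:{0..}|two_point_dist p x. f w) = p * f x + (1 - p) * f 0"
  unfolding set_lebesgue_integral_def two_point_dist_def
  using assms by (subst integral_distr) auto

lemma expected_excess_two_point_dist:
  assumes "0 \<le> p" "p \<le> 1" "0 \<le> q" "q \<le> x"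
  shows "expected_excess (two_point_dist p x) q = p * (x - q)"
  unfolding expected_excess_def using assms
  by (subst set_integral_two_point_dist) auto

text \<open>The atom at 0 adds nothing to either moment, because \<open>0 powr \<alpha> = 0\<close>
  for every real exponent.\<close>

lemma two_point_dist_in_moment_class:
  assumes "0 \<le> p" "p \<le> 1" "0 \<le> x"
  shows "two_point_dist p x \<in> moment_class \<alpha> (p * x) (p * x powr \<alpha>)"
proof -
  have "AE w in two_point_dist p x. 0 \<le> w"
    unfolding two_point_dist_def using assms by (subst AE_distr_iff) auto
  then show ?thesis
    unfolding moment_class_def using assms
    by (auto simp: real_distribution_two_point_dist set_integrable_two_point_dist
        set_integral_two_point_dist)
qed

text \<open>\<open>p\<close> and \<open>x\<close> solve \<open>p * x = m1\<close> and
  \<open>p * x powr \<alpha> = m\<alpha>\<close>. Boundedness is asserted because a real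
  \<open>SUP\<close> is a least upper bound only for a nonempty set bounded above; the two-point law
  gives nonemptiness.\<close>

theorem proposition3p1:
  fixes \<alpha> m1 m\<alpha> p x :: real
  assumes "\<alpha> > 1" and "m1 > 0" and "m\<alpha> > m1 powr \<alpha>"
  defines "p \<equiv> (m1 powr \<alpha> / m\<alpha>) powr (1 / (\<alpha> - 1))"
    and "x \<equiv> (m\<alpha> / m1) powr (1 / (\<alpha> - 1))"
  shows "0 \<le> p \<and> p \<le> 1 \<and> two_point_dist p x \<in> moment_class \<alpha> m1 m\<alpha> \<and>
    (\<forall>q. 0 \<le> q \<and> q \<le> ((\<alpha> - 1) / \<alpha>) * x \<longrightarrow>
      bdd_above ((\<lambda>F. expected_excess F q) ` moment_class \<alpha> m1 m\<alpha>) \<and>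
      (SUP F \<in> moment_class \<alpha> m1 m\<alpha>. expected_excess F q) = m1 - q * p \<and>
      expected_excess (two_point_dist p x) q
        = (SUP F \<in> moment_class \<alpha> m1 m\<alpha>. expected_excess F q))"
proof -
  have m\<alpha>: "m\<alpha> > 0"
    using assms(3) powr_ge_zero[of m1 \<alpha>] by linarith
  have x: "x > 0"
    using m\<alpha> \<open>m1 > 0\<close> by (simp add: x_def)
  have p0: "0 \<le> p"
    by (simp add: p_def)
  \<comment> \<open>The base is below 1 because \<open>m\<alpha> > m1 powr \<alpha>\<close>, and the
    exponent is positive.\<close>
  have "p \<le> 1 powr (1 / (\<alpha> - 1))"
    unfolding p_def using assms m\<alpha> by (intro powr_mono2) auto
  then have p1: "p \<le> 1"
    by simp
  have "p * x = (m1 powr (\<alpha> - 1)) powr (1 / (\<alpha> - 1))"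
    unfolding p_def x_def using m\<alpha> \<open>m1 > 0\<close>
    by (simp flip: powr_mult) (simp add: powr_diff)
  then have px: "p * x = m1"
    using assms by (simp add: powr_powr)
  have "x powr (\<alpha> - 1) = m\<alpha> / m1"
    unfolding x_def using assms m\<alpha> by (simp add: powr_powr)
  then have "x powr \<alpha> = x * (m\<alpha> / m1)"
    using x by (simp add: powr_diff field_simps)
  then have px\<alpha>: "p * x powr \<alpha> = m\<alpha>"
    using px \<open>m1 > 0\<close> by (simp flip: mult.assoc)
  have mem: "two_point_dist p x \<in> moment_class \<alpha> m1 m\<alpha>"
    using two_point_dist_in_moment_class[of p x \<alpha>] p0 p1 x by (simp add: px px\<alpha>)
  have "bdd_above ((\<lambda>F. expected_excess F q) ` moment_class \<alpha> m1 m\<alpha>) \<and>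
      (SUP F \<in> moment_class \<alpha> m1 m\<alpha>. expected_excess F q) = m1 - q * p \<and>
      expected_excess (two_point_dist p x) q
        = (SUP F \<in> moment_class \<alpha> m1 m\<alpha>. expected_excess F q)"
    if q: "0 \<le> q" "q \<le> ((\<alpha> - 1) / \<alpha>) * x" for q
  proof -
    \<comment> \<open>This gives \<open>q \<le> x\<close>, so the excess at the upper atom is
      \<open>x - q\<close>.\<close>
    have "((\<alpha> - 1) / \<alpha>) * x \<le> 1 * x"
      using \<open>\<alpha> > 1\<close> x by (intro mult_right_mono) auto
    then have attained: "expected_excess (two_point_dist p x) q = m1 - q * p"
      using expected_excess_two_point_dist[of p q x] p0 p1 q px by (simp add: algebra_simps)
    \<comment> \<open>With the moments written through \<open>p\<close> and \<open>x\<close>, the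
      bound is \<open>p\<close> times the majorant at \<open>x\<close>, which by tangency is
      \<open>p * (x - q)\<close>.\<close>
    have "(1 - q * \<alpha> / ((\<alpha> - 1) * x)) * m1 + q / ((\<alpha> - 1) * x powr \<alpha>) * m\<alpha> = m1 - q * p"
      unfolding px[symmetric] px\<alpha>[symmetric] using \<open>\<alpha> > 1\<close> x
      by (simp add: divide_simps) (simp add: algebra_simps)
    then have le: "expected_excess F q \<le> m1 - q * p" if "F \<in> moment_class \<alpha> m1 m\<alpha>" for F
      using expected_excess_le[OF \<open>\<alpha> > 1\<close> x q that] by simp
    have "(SUP F \<in> moment_class \<alpha> m1 m\<alpha>. expected_excess F q) = m1 - q * p"
    proof (rule cSup_eq_maximum)
      show "m1 - q * p \<in> (\<lambda>F. expected_excess F q) ` moment_class \<alpha> m1 m\<alpha>"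
        using mem by (rule rev_image_eqI) (simp add: attained)
    qed (use le in auto)
    then show ?thesis
      using le attained by (auto intro!: bdd_aboveI2)
  qed
  then have "\<forall>q. 0 \<le> q \<and> q \<le> ((\<alpha> - 1) / \<alpha>) * x \<longrightarrow>
      bdd_above ((\<lambda>F. expected_excess F q) ` moment_class \<alpha> m1 m\<alpha>) \<and>
      (SUP F \<in> moment_class \<alpha> m1 m\<alpha>. expected_excess F q) = m1 - q * p \<and>
      expected_excess (two_point_dist p x) q
        = (SUP F \<in> moment_class \<alpha> m1 m\<alpha>. expected_excess F q)"
    by (intro allI impI) (elim conjE)
  with p0 p1 mem show ?thesis
    by (intro conjI)
qed

end
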